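(* Let $C$ be any proper closed cone in $\mathbb{R}^n$ and suppose $f: \operatorname{int} C \to \operatorname{int} C$ is order-preserving and homogeneous of degree one with cone spectral radius $\rho(f)=\rho$. Then there exists $y \in C \setminus \{0\}$ such that for any $x \in \operatorname{int} C$ with $x \geq y$, one has $f^k(x) \geq \rho^k y$ for all $k \in \mathbb{N}$.
   Context: Let $n\ge 1$. A closed cone $C \subset \mathbb{R}^n$ is a closed convex set with $C \cap (-C) = \{0\}$ and $\lambda C \subseteq C$ for all $\lambda \ge 0$. It is a proper closed cone if it has nonempty interior $\operatorname{int} C$. The cone defines a partial order on $\mathbb{R}^n$ by $x \le y$ if and only if $y - x \in C$. A map $f: \operatorname{int} C \to \operatorname{int} C$ is order-preserving if $x \le y$ implies $f(x) \le f(y)$, and homogeneous of degree one if $f(\lambda x) = \lambda f(x)$ for all $\lambda > 0$ and $x \in \operatorname{int} C$. For such $f$, the cone spectral radius is $\rho(f) = \lim_{k\to\infty} \|f^k(x)\|^{1/k}$ for any $x \in \operatorname{int} C$, where $f^k$ is the $k$-th iterate of $f$; the limit exists and is independent of $x \in \operatorname{int} C$. *)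

theory Defs
  imports "HOL-Analysis.Analysis"
begin

definition closed_cone :: "'a::real_normed_vector set \<Rightarrow> bool" where
  "closed_cone C \<longleftrightarrow> closed C \<and> convex C \<and> cone C \<and> C \<inter> uminus ` C = {0}"

definition proper_closed_cone :: "'a::real_normed_vector set \<Rightarrow> bool" where
  "proper_closed_cone C \<longleftrightarrow> closed_cone C \<and> interior C \<noteq> {}"

definition cone_le :: "'a::real_normed_vector set \<Rightarrow> 'a \<Rightarrow> 'a \<Rightarrow> bool" where
  "cone_le C x y \<longleftrightarrow> y - x \<in> C"

definition order_preserving :: "'a::real_normed_vector set \<Rightarrow> ('a \<Rightarrow> 'a) \<Rightarrow> bool" where
  "order_preserving C f \<longleftrightarrow> monotone_on (interior C) (cone_le C) (cone_le C) f"

definition homogeneous :: "'a::real_normed_vector set \<Rightarrow> ('a \<Rightarrow> 'a) \<Rightarrow> bool" where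
  "homogeneous C f \<longleftrightarrow> (\<forall>x\<in>interior C. \<forall>c>0. f (c *\<^sub>R x) = c *\<^sub>R f x)"

text \<open>The common value of the limits over all starting points in the interior. The description is
  meaningful when these limits exist and agree, as they do for order-preserving homogeneous
  self-maps of the interior of a proper closed cone in a finite-dimensional space.
  The index \<open>k = 0\<close>, where \<open>root 0 _ = 0\<close>, does not affect
  the limit.\<close>

definition cone_spectral_radius :: "'a::real_normed_vector set \<Rightarrow> ('a \<Rightarrow> 'a) \<Rightarrow> real" where
  "cone_spectral_radius C f =
    (THE r. \<forall>x\<in>interior C. (\<lambda>k. root k (norm ((f ^^ k) x))) \<longlonglongrightarrow> r)"

end

theory Submission
  imports Defs
begin

text \<open>
  If \<open>f\<close> has an eigenvector in the interior of \<open>C\<close>, that eigenvector can serve as \<open>y\<close>; but in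
  general it has none, and \<open>f\<close> need not even extend continuously to the boundary of \<open>C\<close>. So \<open>f\<close> is
  approximated from above by \<open>f\<^sub>\<epsilon> x = f x + \<epsilon> (a \<bullet> x) u\<close>, where \<open>a\<close> is a functional that is
  strictly positive on \<open>C - {0}\<close> and \<open>u\<close> is an interior point. The normalised map
  \<open>f\<^sub>\<epsilon> x / (a \<bullet> f\<^sub>\<epsilon> x)\<close> sends the slice \<open>a \<bullet> x = 1\<close> into a compact convex part of the interior, so
  Brouwer's theorem provides \<open>f\<^sub>\<epsilon> x\<^sub>\<epsilon> = r\<^sub>\<epsilon> x\<^sub>\<epsilon>\<close> with \<open>x\<^sub>\<epsilon>\<close> interior and \<open>a \<bullet> x\<^sub>\<epsilon> = 1\<close>
  (\<open>interior_eigenvector\<close>).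

  As \<open>\<epsilon>\<close> tends to \<open>0\<close> along a suitable sequence, \<open>x\<^sub>\<epsilon>\<close> converges to some \<open>y \<in> C - {0}\<close> and
  \<open>r\<^sub>\<epsilon>\<close> to some \<open>r\<close>. If an interior point \<open>x\<close> dominates \<open>y\<close>, then for each \<open>\<delta> > 0\<close> the point
  \<open>(1 + \<delta>) x\<close> dominates \<open>x\<^sub>\<epsilon>\<close> for all small \<open>\<epsilon>\<close>, because \<open>(1 + \<delta>) x - y\<close> is interior. Iterating
  \<open>f\<^sub>\<epsilon>\<close> and letting first \<open>\<epsilon>\<close> and then \<open>\<delta>\<close> tend to \<open>0\<close> yields that \<open>f\<^sup>k x\<close> dominates
  \<open>r\<^sup>k y\<close> (\<open>limit_of_perturbed_eigenvectors\<close>). This uses continuity of \<open>f\<close> at interior points only,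
  and that continuity is automatic from monotonicity and homogeneity.

  It remains to identify \<open>r\<close> with the spectral radius. The domination just obtained bounds
  \<open>norm (f\<^sup>k x)\<close> below by a multiple of \<open>r\<^sup>k\<close>, while \<open>f x\<^sub>\<epsilon> \<le> f\<^sub>\<epsilon> x\<^sub>\<epsilon> = r\<^sub>\<epsilon> x\<^sub>\<epsilon>\<close> bounds it above by a
  multiple of \<open>r\<^sub>\<epsilon>\<^sup>k\<close>. Hence the \<open>k\<close>-th roots converge to \<open>r\<close> at every interior point; in particular
  the existence of the limit defining the spectral radius is a by-product.
\<close>

section \<open>Proper cones\<close>

locale proper_cone =
  fixes C :: "'a::euclidean_space set"
  assumes proper: "proper_closed_cone C"
begin

abbreviation le (infix "\<preceq>" 50) where "x \<preceq> y \<equiv> cone_le C x y"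

lemma closed_C: "closed C" and convex_C: "convex C" and cone_C: "cone C"
  and int_nonempty: "interior C \<noteq> {}"
  using proper by (auto simp: proper_closed_cone_def closed_cone_def)

lemma zero_mem: "0 \<in> C"
  using proper by (auto simp: proper_closed_cone_def closed_cone_def)

lemma scale_mem: "x \<in> C \<Longrightarrow> 0 \<le> c \<Longrightarrow> c *\<^sub>R x \<in> C"
  using cone_C by (auto simp: cone_def)

lemma add_mem: "x \<in> C \<Longrightarrow> y \<in> C \<Longrightarrow> x + y \<in> C"
  using convex_C cone_C convex_cone by blast

lemma pointed: "x \<in> C \<Longrightarrow> - x \<in> C \<Longrightarrow> x = 0"
proof -
  assume "x \<in> C" "- x \<in> C"
  then have "x \<in> C \<inter> uminus ` C" by (auto intro: image_eqI[of _ _ "- x"])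
  then show "x = 0"
    using proper by (auto simp: proper_closed_cone_def closed_cone_def)
qed

lemma le_refl: "x \<preceq> x"
  by (simp add: cone_le_def zero_mem)

lemma le_trans: "x \<preceq> y \<Longrightarrow> y \<preceq> z \<Longrightarrow> x \<preceq> z"
  using add_mem[of "y - x" "z - y"] by (simp add: cone_le_def)

lemma le_scale: "x \<preceq> y \<Longrightarrow> 0 \<le> c \<Longrightarrow> c *\<^sub>R x \<preceq> c *\<^sub>R y"
  using scale_mem[of "y - x" c] by (simp add: cone_le_def scaleR_diff_right)

lemma le_add: "x \<preceq> y \<Longrightarrow> x' \<preceq> y' \<Longrightarrow> x + x' \<preceq> y + y'"
  using add_mem[of "y - x" "y' - x'"] by (simp add: cone_le_def algebra_simps)

lemma le_limit:
  assumes "X \<longlonglongrightarrow> x" "Y \<longlonglongrightarrow> y" "\<forall>\<^sub>F n in sequentially. X n \<preceq> Y n"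
  shows "x \<preceq> y"
  using Lim_in_closed_set[OF closed_C, of "\<lambda>n. Y n - X n" sequentially "y - x"]
    assms tendsto_diff[OF assms(2,1)] by (simp add: cone_le_def)

lemma interior_mem: "x \<in> interior C \<Longrightarrow> x \<in> C"
  using interior_subset by blast

text \<open>An interior point absorbs every vector, at a rate proportional to its coefficient. This
  quantitative form of interiority is what turns norm estimates into order estimates.\<close>

lemma interior_absorbs:
  assumes "x \<in> interior C"
  obtains \<delta> where "\<delta> > 0" "\<And>t d. 0 \<le> t \<Longrightarrow> norm d \<le> \<delta> * t \<Longrightarrow> t *\<^sub>R x + d \<in> C"
proof -
  obtain e where e: "e > 0" "cball x e \<subseteq> C"
    using assms by (auto simp: mem_interior_cball)
  have "t *\<^sub>R x + d \<in> C" if "0 \<le> t" "norm d \<le> e * t" for t d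
  proof (cases "t = 0")
    case True
    then show ?thesis using that zero_mem by simp
  next
    case False
    with that have "x + (1 / t) *\<^sub>R d \<in> cball x e"
      by (simp add: dist_norm divide_simps)
    with e have "t *\<^sub>R (x + (1 / t) *\<^sub>R d) \<in> C" using that scale_mem by blast
    then show ?thesis using False by (simp add: scaleR_add_right)
  qed
  with e show thesis using that by blast
qed

lemma interior_dominates:
  assumes "u \<in> interior C"
  obtains L where "L > 0" "\<And>x. x \<preceq> (L * norm x) *\<^sub>R u"
proof -
  obtain \<delta> where d: "\<delta> > 0" "\<And>t d. 0 \<le> t \<Longrightarrow> norm d \<le> \<delta> * t \<Longrightarrow> t *\<^sub>R u + d \<in> C"
    using interior_absorbs[OF assms] by metis
  have "x \<preceq> (1 / \<delta> * norm x) *\<^sub>R u" for x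
    using d(1) d(2)[of "1 / \<delta> * norm x" "- x"] by (simp add: cone_le_def)
  with d(1) show thesis using that[of "1 / \<delta>"] by simp
qed

lemma interior_add:
  assumes "x \<in> interior C" "y \<in> C"
  shows "x + y \<in> interior C"
proof -
  have "(+) y ` interior C \<subseteq> interior C"
    by (rule interior_maximal) (auto intro: add_mem assms interior_mem open_translation)
  then show ?thesis using assms by (auto simp: add.commute)
qed

lemma interior_upward: "x \<in> interior C \<Longrightarrow> x \<preceq> y \<Longrightarrow> y \<in> interior C"
  using interior_add[of x "y - x"] by (simp add: cone_le_def)

lemma interior_scale:
  assumes "x \<in> interior C" "c > 0"
  shows "c *\<^sub>R x \<in> interior C"
proof -
  have "(*\<^sub>R) c ` interior C \<subseteq> interior C"
    using assms(2) by (intro interior_maximal) (auto intro: scale_mem interior_mem open_scaling)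
  then show ?thesis using assms by auto
qed

text \<open>Pointedness makes \<open>C - {0}\<close> convex, so the convex hull of the unit vectors of \<open>C\<close> is a compact
  set that misses the origin; a hyperplane separating it from the origin gives the functional.\<close>

lemma strictly_positive_functional:
  obtains a b where "b > 0" "\<And>x. x \<in> C \<Longrightarrow> b * norm x \<le> a \<bullet> x"
proof -
  let ?H = "convex hull (C \<inter> sphere 0 1)"
  have "convex (C - {0})"
    unfolding convex_alt
  proof clarify
    fix x y and t :: real
    assume xy: "x \<in> C" "y \<in> C" "x \<noteq> 0" "y \<noteq> 0" and t: "0 \<le> t" "t \<le> 1"
    have mem: "(1 - t) *\<^sub>R x \<in> C" "t *\<^sub>R y \<in> C" using xy t scale_mem by auto
    have "(1 - t) *\<^sub>R x + t *\<^sub>R y \<noteq> 0"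
    proof
      assume eq: "(1 - t) *\<^sub>R x + t *\<^sub>R y = 0"
      then have "- ((1 - t) *\<^sub>R x) = t *\<^sub>R y" by (rule minus_unique)
      with mem pointed have "(1 - t) *\<^sub>R x = 0" by metis
      with eq xy show False by auto
    qed
    with mem add_mem show "(1 - t) *\<^sub>R x + t *\<^sub>R y \<in> C - {0}" by auto
  qed
  then have "?H \<subseteq> C - {0}" by (intro hull_minimal) auto
  moreover have "compact ?H"
    using closed_C by (intro compact_convex_hull) (simp add: closed_Int_compact)
  ultimately obtain a b where ab: "0 < b" "\<forall>x\<in>?H. b < a \<bullet> x"
    using separating_hyperplane_closed_0[of ?H] by (auto simp: convex_convex_hull compact_imp_closed)
  have "b * norm x \<le> a \<bullet> x" if "x \<in> C" for x
  proof (cases "x = 0")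
    case False
    then have "(1 / norm x) *\<^sub>R x \<in> ?H"
      using that scale_mem[of x "1 / norm x"] by (intro hull_inc) auto
    with ab have "b < a \<bullet> ((1 / norm x) *\<^sub>R x)" by blast
    then show ?thesis using False by (simp add: field_simps)
  qed simp
  with ab show thesis using that by blast
qed

lemma functional_nonneg:
  fixes b :: real
  assumes "b > 0" "\<And>x. x \<in> C \<Longrightarrow> b * norm x \<le> a \<bullet> x" "x \<in> C"
  shows "0 \<le> a \<bullet> x"
proof -
  have "0 \<le> b * norm x" using assms(1) by simp
  also have "\<dots> \<le> a \<bullet> x" using assms(2,3) .
  finally show ?thesis .
qed

lemma normality:
  obtains K where "K > 0" "\<And>v w. 0 \<preceq> v \<Longrightarrow> v \<preceq> w \<Longrightarrow> norm v \<le> K * norm w"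
proof -
  obtain a b where ab: "b > 0" "\<And>x. x \<in> C \<Longrightarrow> b * norm x \<le> a \<bullet> x"
    using strictly_positive_functional by metis
  have "norm v \<le> (norm a + 1) / b * norm w" if "0 \<preceq> v" "v \<preceq> w" for v w
  proof -
    have "0 \<le> b * norm (w - v)" using ab(1) by simp
    also have "\<dots> \<le> a \<bullet> (w - v)" using ab(2) that by (simp add: cone_le_def)
    finally have "b * norm v \<le> a \<bullet> w"
      using ab(2)[of v] that by (simp add: cone_le_def inner_diff_right)
    also have "\<dots> \<le> norm a * norm w" by (rule norm_cauchy_schwarz)
    also have "\<dots> \<le> (norm a + 1) * norm w" by (simp add: algebra_simps)
    finally show ?thesis using ab(1) by (simp add: field_simps)
  qed
  moreover have "(norm a + 1) / b > 0"
    using ab(1) by (intro divide_pos_pos add_nonneg_pos) auto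
  ultimately show thesis using that by blast
qed

end

section \<open>Order-preserving homogeneous maps\<close>

locale cone_selfmap = proper_cone +
  fixes f :: "'a \<Rightarrow> 'a"
  assumes maps: "f \<in> interior C \<rightarrow> interior C"
    and order_pres: "order_preserving C f"
    and homog: "homogeneous C f"
begin

lemma f_interior: "x \<in> interior C \<Longrightarrow> f x \<in> interior C"
  using maps by auto

lemma f_mono: "x \<in> interior C \<Longrightarrow> y \<in> interior C \<Longrightarrow> x \<preceq> y \<Longrightarrow> f x \<preceq> f y"
  using order_pres by (auto simp: order_preserving_def monotone_on_def)

lemma f_scale: "x \<in> interior C \<Longrightarrow> c > 0 \<Longrightarrow> f (c *\<^sub>R x) = c *\<^sub>R f x"
  using homog by (auto simp: homogeneous_def)

lemma cone_selfmap_funpow: "cone_selfmap C (f ^^ k)"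
proof (induction k)
  case 0
  show ?case
    by unfold_locales (auto simp: order_preserving_def monotone_on_def homogeneous_def)
next
  case (Suc k)
  then interpret g: cone_selfmap C "f ^^ k" .
  show ?case
    by unfold_locales
      (auto simp: order_preserving_def monotone_on_def homogeneous_def
        intro!: f_interior f_mono g.f_interior g.f_mono simp: f_scale g.f_scale g.f_interior)
qed

text \<open>Points near \<open>x\<close> lie in the order interval between \<open>(1 - t) x\<close> and \<open>(1 + t) x\<close>, hence their
  images lie between \<open>(1 - t) f x\<close> and \<open>(1 + t) f x\<close>, and such an interval is small in norm.\<close>

lemma continuous_on_interior: "continuous_on (interior C) f"
  unfolding continuous_on_iff
proof (intro ballI allI impI)
  fix x and e :: real assume x: "x \<in> interior C" and e: "e > 0"
  obtain \<delta> where \<delta>: "\<delta> > 0" "\<And>t d. 0 \<le> t \<Longrightarrow> norm d \<le> \<delta> * t \<Longrightarrow> t *\<^sub>R x + d \<in> C"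
    using interior_absorbs[OF x] by metis
  obtain K where K: "K > 0" "\<And>v w. 0 \<preceq> v \<Longrightarrow> v \<preceq> w \<Longrightarrow> norm v \<le> K * norm w"
    using normality by metis
  define M where "M = (2 * K + 1) * (norm (f x) + 1)"
  have M: "M > 0" unfolding M_def using K(1) by (intro mult_pos_pos add_nonneg_pos) auto
  define t where "t = min (1 / 2) (e / (2 * M))"
  have t: "0 < t" "t < 1" "t * M < e"
  proof -
    show "0 < t" "t < 1" using e M by (auto simp: t_def)
    have "t * M \<le> e / (2 * M) * M" using M by (intro mult_right_mono) (auto simp: t_def)
    with e M show "t * M < e" by simp
  qed
  have "dist (f z) (f x) < e" if z: "z \<in> interior C" "dist z x < \<delta> * t" for z
  proof -
    have "norm (z - x) \<le> \<delta> * t" "norm (x - z) \<le> \<delta> * t"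
      using z by (auto simp: dist_norm norm_minus_commute)
    then have "t *\<^sub>R x + (z - x) \<in> C" "t *\<^sub>R x + (x - z) \<in> C" using \<delta>(2) t by auto
    then have "(1 - t) *\<^sub>R x \<preceq> z" "z \<preceq> (1 + t) *\<^sub>R x"
      by (auto simp: cone_le_def algebra_simps)
    then have "f ((1 - t) *\<^sub>R x) \<preceq> f z" "f z \<preceq> f ((1 + t) *\<^sub>R x)"
      using x z t by (auto intro!: f_mono interior_scale)
    then have "(1 - t) *\<^sub>R f x \<preceq> f z" "f z \<preceq> (1 + t) *\<^sub>R f x"
      using x t by (simp_all add: f_scale)
    then have "0 \<preceq> (f z - f x) + t *\<^sub>R f x" "(f z - f x) + t *\<^sub>R f x \<preceq> t *\<^sub>R f x + t *\<^sub>R f x"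
      by (auto simp: cone_le_def algebra_simps)
    then have "norm ((f z - f x) + t *\<^sub>R f x) \<le> K * norm (t *\<^sub>R f x + t *\<^sub>R f x)" by (rule K(2))
    then have "norm (f z - f x) \<le> K * norm (t *\<^sub>R f x + t *\<^sub>R f x) + norm (t *\<^sub>R f x)"
      using norm_triangle_ineq4[of "(f z - f x) + t *\<^sub>R f x" "t *\<^sub>R f x"] by simp
    also have "\<dots> = t * ((2 * K + 1) * norm (f x))"
      using t by (simp add: algebra_simps flip: scaleR_2)
    also have "\<dots> \<le> t * M" unfolding M_def using t K(1) by (intro mult_left_mono) auto
    finally show ?thesis using t by (simp add: dist_norm)
  qed
  then show "\<exists>d>0. \<forall>z\<in>interior C. dist z x < d \<longrightarrow> dist (f z) (f x) < e"
    using \<delta>(1) t(1) by (intro exI[of _ "\<delta> * t"]) auto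
qed

text \<open>A bound on how much \<open>f\<close> can stretch the functional, uniform up to the boundary of \<open>C\<close>: each
  \<open>x \<in> C\<close> is dominated by a fixed interior point scaled by a constant times \<open>a \<bullet> x\<close>. It keeps
  the normalised maps away from the boundary and the perturbed eigenvalues bounded.\<close>

lemma functional_bound:
  assumes ab: "b > 0" "\<And>x. x \<in> C \<Longrightarrow> b * norm x \<le> a \<bullet> x"
  obtains L where "L > 0" "\<And>x. x \<in> interior C \<Longrightarrow> a \<bullet> f x \<le> L * (a \<bullet> x)"
proof -
  obtain u where u: "u \<in> interior C" using int_nonempty by blast
  obtain M where M: "M > 0" "\<And>x. x \<preceq> (M * norm x) *\<^sub>R u"
    using interior_dominates[OF u] by metis
  have nonneg: "0 \<le> a \<bullet> x" if "x \<in> C" for x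
    using functional_nonneg[OF ab that] .
  have mono: "a \<bullet> x \<le> a \<bullet> y" if "x \<preceq> y" for x y
    using nonneg[of "y - x"] that by (simp add: cone_le_def inner_diff_right)
  let ?L = "M / b * (a \<bullet> f u) + 1"
  have fu: "0 \<le> a \<bullet> f u" using u by (intro nonneg interior_mem f_interior)
  have "a \<bullet> f x \<le> ?L * (a \<bullet> x)" if x: "x \<in> interior C" for x
  proof (cases "x = 0")
    case True
    \<comment> \<open>By pointedness the origin is interior only in the zero space, where both sides vanish.\<close>
    have "f x = 2 *\<^sub>R f x" using f_scale[OF x, of 2] True by simp
    then have "f x = 0" by (simp add: scaleR_2)
    with True show ?thesis by simp
  next
    case False
    have "a \<bullet> f x \<le> a \<bullet> f ((M * norm x) *\<^sub>R u)"
      using x u M False by (intro mono f_mono interior_scale) auto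
    also have "\<dots> = M * norm x * (a \<bullet> f u)" using u M(1) False by (simp add: f_scale)
    also have "\<dots> \<le> M * ((a \<bullet> x) / b) * (a \<bullet> f u)"
      using ab(1) ab(2)[OF interior_mem[OF x]] M(1) fu
      by (intro mult_right_mono mult_left_mono) (auto simp: field_simps)
    also have "\<dots> \<le> ?L * (a \<bullet> x)" 
      using nonneg[OF interior_mem[OF x]] by (simp add: algebra_simps)
    finally show ?thesis .
  qed
  moreover have "?L > 0" using M(1) ab(1) fu by (simp add: add_nonneg_pos)
  ultimately show thesis using that by blast
qed

text \<open>The lower bound on \<open>f\<close> keeps the normalised map \<open>f x / (a \<bullet> f x)\<close> at a fixed distance from the
  boundary of \<open>C\<close>, which makes Brouwer's theorem applicable although \<open>f\<close> is controlled only in the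
  interior.\<close>

lemma interior_eigenvector:
  assumes ab: "b > 0" "\<And>x. x \<in> C \<Longrightarrow> b * norm x \<le> a \<bullet> x"
    and u: "u \<in> interior C" "u \<noteq> 0" and \<epsilon>: "\<epsilon> > 0"
    and lower: "\<And>x. x \<in> interior C \<Longrightarrow> (\<epsilon> * (a \<bullet> x)) *\<^sub>R u \<preceq> f x"
  obtains x r where "x \<in> interior C" "a \<bullet> x = 1" "r > 0" "f x = r *\<^sub>R x"
proof -
  obtain L where L: "L > 0" "\<And>x. x \<in> interior C \<Longrightarrow> a \<bullet> f x \<le> L * (a \<bullet> x)"
    using functional_bound[OF ab] by metis
  define s where "s = \<epsilon> / L"
  have s: "s > 0" using \<epsilon> L by (simp add: s_def)
  define S where "S = {x. a \<bullet> x = 1 \<and> s *\<^sub>R u \<preceq> x}"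
  have nonneg: "0 \<le> a \<bullet> x" if "x \<in> C" for x
    using functional_nonneg[OF ab that] .
  have au: "a \<bullet> u > 0"
    using ab(1) ab(2)[OF interior_mem[OF u(1)]] u(2)
    by (meson zero_less_norm_iff mult_pos_pos less_le_trans)
  have S_int: "x \<in> interior C" if "x \<in> S" for x
    using that s u by (auto simp: S_def intro: interior_upward interior_scale)
  have pos: "a \<bullet> f x > 0" if "x \<in> interior C" "a \<bullet> x = 1" for x
  proof -
    have "0 < \<epsilon> * (a \<bullet> u)" using \<epsilon> au by simp
    also have "\<dots> \<le> a \<bullet> f x"
      using lower[OF that(1)] nonneg[of "f x - \<epsilon> *\<^sub>R u"] that(2)
      by (simp add: cone_le_def inner_diff_right)
    finally show ?thesis .
  qed
  define g where "g x = (1 / (a \<bullet> f x)) *\<^sub>R f x" for x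
  have g_in: "g x \<in> S" if x: "x \<in> interior C" "a \<bullet> x = 1" for x
  proof -
    have "s * (a \<bullet> f x) \<le> s * L" using L(2)[OF x(1)] x(2) s by simp
    then have "s \<le> \<epsilon> / (a \<bullet> f x)" using L(1) pos[OF x] by (simp add: s_def field_simps)
    then have "s *\<^sub>R u \<preceq> (\<epsilon> / (a \<bullet> f x)) *\<^sub>R u"
      using scale_mem[OF interior_mem[OF u(1)], of "\<epsilon> / (a \<bullet> f x) - s"]
      by (simp add: cone_le_def scaleR_diff_left)
    moreover have "(\<epsilon> / (a \<bullet> f x)) *\<^sub>R u \<preceq> g x"
      using le_scale[OF lower[OF x(1)], of "1 / (a \<bullet> f x)"] pos[OF x] x(2) by (simp add: g_def)
    ultimately show ?thesis using le_trans pos[OF x] by (auto simp: S_def g_def)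
  qed
  have "S \<subseteq> cball 0 (1 / b)"
  proof
    fix x assume "x \<in> S"
    then show "x \<in> cball 0 (1 / b)"
      using ab(1) ab(2)[OF interior_mem[OF S_int]] by (auto simp: S_def field_simps)
  qed
  then have "bounded S" using bounded_subset bounded_cball by blast
  have S_eq: "S = {x. a \<bullet> x = 1} \<inter> (+) (s *\<^sub>R u) ` C"
    by (auto simp: S_def cone_le_def intro: image_eqI[of _ _ "_ - s *\<^sub>R u"])
  have "closed S"
    unfolding S_eq using closed_C by (intro closed_Int closed_hyperplane closed_translation)
  with \<open>bounded S\<close> have "compact S" by (simp add: compact_eq_bounded_closed)
  moreover have "convex S"
    unfolding S_eq using convex_C by (intro convex_Int convex_hyperplane convex_translation)
  moreover have "S \<noteq> {}"
    using g_in[of "(1 / (a \<bullet> u)) *\<^sub>R u"] interior_scale[OF u(1), of "1 / (a \<bullet> u)"] au by auto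
  moreover have "continuous_on S g"
    unfolding g_def
  proof (intro continuous_intros)
    show "continuous_on S f" and "continuous_on S f"
      using continuous_on_subset[OF continuous_on_interior] S_int by auto
    show "\<forall>x\<in>S. a \<bullet> f x \<noteq> 0" using pos S_int by (force simp: S_def)
  qed
  moreover have "g \<in> S \<rightarrow> S" using g_in S_int by (auto simp: S_def)
  ultimately obtain x where x: "x \<in> S" "g x = x" using brouwer by blast
  then have int: "x \<in> interior C" "a \<bullet> x = 1" using S_int by (auto simp: S_def)
  have "f x = (a \<bullet> f x) *\<^sub>R g x" using pos[OF int] by (simp add: g_def)
  with x int pos[OF int] show thesis using that by metis
qed

lemma funpow_subeigenvector:
  assumes x: "x \<in> interior C" and r: "r > 0" and le: "f x \<preceq> r *\<^sub>R x"
  shows "(f ^^ k) x \<preceq> r ^ k *\<^sub>R x"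
proof (induction k)
  case 0
  show ?case by (simp add: le_refl)
next
  case (Suc k)
  interpret g: cone_selfmap C "f ^^ k" by (rule cone_selfmap_funpow)
  have "f ((f ^^ k) x) \<preceq> f (r ^ k *\<^sub>R x)"
    using Suc x r by (intro f_mono g.f_interior interior_scale) auto
  also have "f (r ^ k *\<^sub>R x) = r ^ k *\<^sub>R f x" using x r by (simp add: f_scale)
  finally have "f ((f ^^ k) x) \<preceq> r ^ k *\<^sub>R f x" .
  moreover have "r ^ k *\<^sub>R f x \<preceq> r ^ k *\<^sub>R r *\<^sub>R x" using le r by (intro le_scale) auto
  ultimately show ?case using le_trans by (simp add: mult.commute)
qed

lemma norm_funpow_upper:
  assumes x: "x \<in> interior C" "f x \<preceq> r *\<^sub>R x" and r: "r > 0" and z: "z \<in> interior C" "z \<noteq> 0"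
  obtains B where "B > 0" "\<And>k. norm ((f ^^ k) z) \<le> B * r ^ k"
proof -
  obtain K where K: "K > 0" "\<And>v w. 0 \<preceq> v \<Longrightarrow> v \<preceq> w \<Longrightarrow> norm v \<le> K * norm w"
    using normality by metis
  obtain M where M: "M > 0" "\<And>v. v \<preceq> (M * norm v) *\<^sub>R x"
    using interior_dominates[OF x(1)] by metis
  define t where "t = M * norm z"
  have t: "t > 0" "z \<preceq> t *\<^sub>R x" using M z(2) by (auto simp: t_def)
  have "norm ((f ^^ k) z) \<le> (K * t * norm x + 1) * r ^ k" for k
  proof -
    interpret g: cone_selfmap C "f ^^ k" by (rule cone_selfmap_funpow)
    have "(f ^^ k) z \<preceq> (f ^^ k) (t *\<^sub>R x)"
      using t x z by (intro g.f_mono interior_scale) auto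
    also have "(f ^^ k) (t *\<^sub>R x) = t *\<^sub>R (f ^^ k) x" using t x by (simp add: g.f_scale)
    finally have "(f ^^ k) z \<preceq> t *\<^sub>R r ^ k *\<^sub>R x"
      using le_scale[OF funpow_subeigenvector[OF x(1) r x(2)], of t k] t le_trans by auto
    moreover have "0 \<preceq> (f ^^ k) z"
      using interior_mem[OF g.f_interior[OF z(1)]] by (simp add: cone_le_def)
    ultimately have "norm ((f ^^ k) z) \<le> K * norm (t *\<^sub>R r ^ k *\<^sub>R x)" using K(2) by blast
    also have "\<dots> = K * t * norm x * r ^ k" using t r by simp
    also have "\<dots> \<le> (K * t * norm x + 1) * r ^ k" using r by (simp add: algebra_simps)
    finally show ?thesis .
  qed
  moreover have "K * t * norm x + 1 > 0" using K(1) t(1) by (simp add: add_nonneg_pos)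
  ultimately show thesis using that by blast
qed

section \<open>The limit of the eigenvectors of the perturbed maps\<close>

lemma perturbation:
  assumes ab: "b > 0" "\<And>x. x \<in> C \<Longrightarrow> b * norm x \<le> a \<bullet> x"
    and u: "u \<in> interior C" and \<epsilon>: "\<epsilon> > 0"
  shows "cone_selfmap C (\<lambda>x. f x + (\<epsilon> * (a \<bullet> x)) *\<^sub>R u)"
proof unfold_locales
  have nonneg: "0 \<le> a \<bullet> x" if "x \<in> C" for x
    using functional_nonneg[OF ab that] .
  show "(\<lambda>x. f x + (\<epsilon> * (a \<bullet> x)) *\<^sub>R u) \<in> interior C \<rightarrow> interior C"
  proof
    fix x assume x: "x \<in> interior C"
    then have "0 \<le> \<epsilon> * (a \<bullet> x)" using \<epsilon> nonneg[OF interior_mem] by simp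
    then show "f x + (\<epsilon> * (a \<bullet> x)) *\<^sub>R u \<in> interior C"
      by (intro interior_add[OF f_interior[OF x]] scale_mem interior_mem[OF u])
  qed
  show "homogeneous C (\<lambda>x. f x + (\<epsilon> * (a \<bullet> x)) *\<^sub>R u)"
    by (auto simp: homogeneous_def f_scale algebra_simps)
  show "order_preserving C (\<lambda>x. f x + (\<epsilon> * (a \<bullet> x)) *\<^sub>R u)"
    unfolding order_preserving_def monotone_on_def
  proof (intro ballI impI le_add allI)
    fix x y assume xy: "x \<in> interior C" "y \<in> interior C" "x \<preceq> y"
    then show "f x \<preceq> f y" by (rule f_mono)
    have "0 \<le> a \<bullet> (y - x)" using xy nonneg by (simp add: cone_le_def)
    then have "(\<epsilon> * (a \<bullet> (y - x))) *\<^sub>R u \<in> C"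
      using \<epsilon> u by (intro scale_mem interior_mem) auto
    then show "(\<epsilon> * (a \<bullet> x)) *\<^sub>R u \<preceq> (\<epsilon> * (a \<bullet> y)) *\<^sub>R u"
      by (simp add: cone_le_def algebra_simps)
  qed
qed

text \<open>Orbits of the perturbed maps that start at an interior point stay near an orbit of \<open>f\<close>, which is
  itself interior, so that only interior continuity of \<open>f\<close> enters.\<close>

lemma perturbed_funpow_tendsto:
  assumes \<epsilon>: "\<epsilon> \<longlonglongrightarrow> (0::real)" and x: "x \<in> interior C"
    and g: "\<And>n. cone_selfmap C (\<lambda>x. f x + (\<epsilon> n * (a \<bullet> x)) *\<^sub>R u)"
  shows "(\<lambda>n. ((\<lambda>x. f x + (\<epsilon> n * (a \<bullet> x)) *\<^sub>R u) ^^ k) x) \<longlonglongrightarrow> (f ^^ k) x"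
proof (induction k)
  case (Suc k)
  interpret h: cone_selfmap C "f ^^ k" by (rule cone_selfmap_funpow)
  define Z where "Z n = ((\<lambda>x. f x + (\<epsilon> n * (a \<bullet> x)) *\<^sub>R u) ^^ k) x" for n
  have Z: "Z n \<in> interior C" for n
    unfolding Z_def
    using cone_selfmap.f_interior[OF cone_selfmap.cone_selfmap_funpow[OF g] x] .
  have lim: "Z \<longlonglongrightarrow> (f ^^ k) x" using Suc unfolding Z_def .
  have "(\<lambda>n. f (Z n)) \<longlonglongrightarrow> f ((f ^^ k) x)"
    using continuous_on_tendsto_compose[OF continuous_on_interior lim] Z h.f_interior[OF x] by simp
  then have "(\<lambda>n. f (Z n) + (\<epsilon> n * (a \<bullet> Z n)) *\<^sub>R u)
      \<longlonglongrightarrow> f ((f ^^ k) x) + (0 * (a \<bullet> (f ^^ k) x)) *\<^sub>R u"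
    by (intro tendsto_intros lim \<epsilon>)
  then show ?case by (simp add: Z_def)
qed simp

text \<open>The scalars \<open>r'\<close> are eigenvalues of perturbed maps; their eigenvectors are only
  sub-eigenvectors of \<open>f\<close>, which is all that an upper bound on its growth requires.\<close>

lemma limit_of_perturbed_eigenvectors:
  assumes "u \<in> interior C" "u \<noteq> 0"
  obtains y r where "y \<in> C" "y \<noteq> 0" "r \<ge> 0"
    "\<And>x k. x \<in> interior C \<Longrightarrow> y \<preceq> x \<Longrightarrow> r ^ k *\<^sub>R y \<preceq> (f ^^ k) x"
    "\<And>s. r < s \<Longrightarrow> \<exists>x\<in>interior C. \<exists>r'>0. r' < s \<and> f x \<preceq> r' *\<^sub>R x"
proof -
  obtain a b where ab: "b > 0" "\<And>x. x \<in> C \<Longrightarrow> b * norm x \<le> a \<bullet> x"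
    using strictly_positive_functional by metis
  have nonneg: "0 \<le> a \<bullet> x" if "x \<in> C" for x
    using functional_nonneg[OF ab that] .
  define \<epsilon> where "\<epsilon> n = 1 / real (Suc n)" for n
  define F where "F n = (\<lambda>x. f x + (\<epsilon> n * (a \<bullet> x)) *\<^sub>R u)" for n
  have \<epsilon>: "\<epsilon> n > 0" "\<epsilon> n \<le> 1" for n by (auto simp: \<epsilon>_def)
  have \<epsilon>_lim: "\<epsilon> \<longlonglongrightarrow> 0" unfolding \<epsilon>_def by (rule LIMSEQ_Suc[OF lim_1_over_n])
  have F: "cone_selfmap C (F n)" for n
    unfolding F_def by (rule perturbation[OF ab assms(1) \<epsilon>(1)])
  have "\<exists>x r. x \<in> interior C \<and> a \<bullet> x = 1 \<and> r > 0 \<and> F n x = r *\<^sub>R x" for n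
  proof -
    have low: "(\<epsilon> n * (a \<bullet> x)) *\<^sub>R u \<preceq> F n x" if "x \<in> interior C" for x
      using interior_mem[OF f_interior[OF that]] by (simp add: F_def cone_le_def)
    show ?thesis
      using cone_selfmap.interior_eigenvector[OF F ab assms \<epsilon>(1) low] by metis
  qed
  then obtain X R where XR: "\<And>n. X n \<in> interior C" "\<And>n. a \<bullet> X n = 1" "\<And>n. R n > 0"
    "\<And>n. F n (X n) = R n *\<^sub>R X n" by metis
  obtain L where L: "L > 0" "\<And>x. x \<in> interior C \<Longrightarrow> a \<bullet> f x \<le> L * (a \<bullet> x)"
    using functional_bound[OF ab] by metis
  have "R n \<le> L + a \<bullet> u" for n
  proof -
    have "R n = a \<bullet> F n (X n)" using XR(2,4) by simp
    also have "\<dots> = a \<bullet> f (X n) + \<epsilon> n * (a \<bullet> u)"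
      using XR(2) by (simp add: F_def inner_add_right)
    also have "\<dots> \<le> L + 1 * (a \<bullet> u)"
      using L(2)[OF XR(1), of n] XR(2)[of n] \<epsilon>[of n] nonneg[OF interior_mem[OF assms(1)]]
      by (intro add_mono mult_right_mono) auto
    finally show ?thesis by simp
  qed
  moreover have "norm (X n) \<le> 1 / b" for n
    using ab(1) ab(2)[OF interior_mem[OF XR(1)], of n] XR(2)[of n] by (simp add: field_simps)
  ultimately have XR_mem: "(X n, R n) \<in> cball 0 (1 / b) \<times> {0..L + a \<bullet> u}" for n
    using XR(3)[of n] by auto
  have "seq_compact (cball (0::'a) (1 / b) \<times> {0..L + a \<bullet> u})"
    by (intro compact_imp_seq_compact compact_Times) auto
  then obtain l \<phi> where \<phi>: "strict_mono \<phi>" "((\<lambda>n. (X n, R n)) \<circ> \<phi>) \<longlonglongrightarrow> l"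
    using seq_compactE[of _ "\<lambda>n. (X n, R n)"] XR_mem by blast
  define y r where "y = fst l" and "r = snd l"
  have X_lim: "(\<lambda>n. X (\<phi> n)) \<longlonglongrightarrow> y" and R_lim: "(\<lambda>n. R (\<phi> n)) \<longlonglongrightarrow> r"
    using tendsto_fst[OF \<phi>(2)] tendsto_snd[OF \<phi>(2)] by (auto simp: y_def r_def comp_def)
  have \<epsilon>_lim': "(\<lambda>n. \<epsilon> (\<phi> n)) \<longlonglongrightarrow> 0"
    using LIMSEQ_subseq_LIMSEQ[OF \<epsilon>_lim \<phi>(1)] by (simp add: comp_def)
  have "y \<in> C"
    using Lim_in_closed_set[OF closed_C _ _ X_lim] interior_mem[OF XR(1)] by simp
  moreover have "y \<noteq> 0"
  proof -
    have "(\<lambda>n. a \<bullet> X (\<phi> n)) \<longlonglongrightarrow> a \<bullet> y" by (intro tendsto_intros X_lim)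
    with XR(2) have "a \<bullet> y = 1" by (simp add: LIMSEQ_const_iff)
    then show ?thesis by auto
  qed
  moreover have "r \<ge> 0"
    using LIMSEQ_le_const[OF R_lim] XR(3) less_imp_le by blast
  moreover have "r ^ k *\<^sub>R y \<preceq> (f ^^ k) x" if x: "x \<in> interior C" "y \<preceq> x" for x k
  proof -
    interpret g: cone_selfmap C "f ^^ k" by (rule cone_selfmap_funpow)
    \<comment> \<open>The dilation by \<open>1 + \<delta>\<close> turns \<open>y \<preceq> x\<close> into a strict relation, which is stable under
      replacing \<open>y\<close> by a nearby \<open>X (\<phi> n)\<close>.\<close>
    have step: "r ^ k *\<^sub>R y \<preceq> (1 + \<delta>) *\<^sub>R (f ^^ k) x" if \<delta>: "\<delta> > 0" for \<delta>
    proof -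
      have x': "(1 + \<delta>) *\<^sub>R x \<in> interior C" using x \<delta> by (intro interior_scale) auto
      have "\<delta> *\<^sub>R x + (x - y) \<in> interior C"
        using x \<delta> by (intro interior_add interior_scale) (auto simp: cone_le_def)
      moreover have "(\<lambda>n. (1 + \<delta>) *\<^sub>R x - X (\<phi> n)) \<longlonglongrightarrow> (1 + \<delta>) *\<^sub>R x - y"
        by (intro tendsto_intros X_lim)
      ultimately have "\<forall>\<^sub>F n in sequentially. (1 + \<delta>) *\<^sub>R x - X (\<phi> n) \<in> interior C"
        by (intro topological_tendstoD) (auto simp: algebra_simps)
      then have "\<forall>\<^sub>F n in sequentially.
          R (\<phi> n) ^ k *\<^sub>R X (\<phi> n) \<preceq> (F (\<phi> n) ^^ k) ((1 + \<delta>) *\<^sub>R x)"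
      proof eventually_elim
        case (elim n)
        interpret h: cone_selfmap C "F (\<phi> n)" by (rule F)
        interpret h': cone_selfmap C "F (\<phi> n) ^^ k" by (rule h.cone_selfmap_funpow)
        have "(F (\<phi> n) ^^ j) (X (\<phi> n)) = R (\<phi> n) ^ j *\<^sub>R X (\<phi> n)" for j
          by (induction j) (simp_all add: h.f_scale XR mult.commute)
        moreover have "X (\<phi> n) \<preceq> (1 + \<delta>) *\<^sub>R x"
          using interior_mem[OF elim] by (simp add: cone_le_def)
        then have "(F (\<phi> n) ^^ k) (X (\<phi> n)) \<preceq> (F (\<phi> n) ^^ k) ((1 + \<delta>) *\<^sub>R x)"
          by (intro h'.f_mono XR x')
        ultimately show ?case by simp
      qed
      moreover have "(\<lambda>n. R (\<phi> n) ^ k *\<^sub>R X (\<phi> n)) \<longlonglongrightarrow> r ^ k *\<^sub>R y"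
        by (intro tendsto_intros X_lim R_lim)
      moreover have "(\<lambda>n. (F (\<phi> n) ^^ k) ((1 + \<delta>) *\<^sub>R x)) \<longlonglongrightarrow> (f ^^ k) ((1 + \<delta>) *\<^sub>R x)"
        unfolding F_def
        using perturbed_funpow_tendsto[OF \<epsilon>_lim' x' F[unfolded F_def]] .
      ultimately have "r ^ k *\<^sub>R y \<preceq> (f ^^ k) ((1 + \<delta>) *\<^sub>R x)" by (intro le_limit)
      then show ?thesis using x \<delta> by (simp add: g.f_scale)
    qed
    have "(\<lambda>n. (1 + \<epsilon> n) *\<^sub>R (f ^^ k) x) \<longlonglongrightarrow> (1 + 0) *\<^sub>R (f ^^ k) x"
      by (intro tendsto_intros \<epsilon>_lim)
    then have "r ^ k *\<^sub>R y \<preceq> (1 + 0) *\<^sub>R (f ^^ k) x"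
      using step \<epsilon>(1) by (intro le_limit[OF tendsto_const]) auto
    then show ?thesis by simp
  qed
  moreover have "\<exists>x\<in>interior C. \<exists>r'>0. r' < s \<and> f x \<preceq> r' *\<^sub>R x" if "r < s" for s
  proof -
    obtain n where n: "R (\<phi> n) < s"
      using order_tendstoD(2)[OF R_lim \<open>r < s\<close>] eventually_happens'[OF sequentially_bot] by blast
    let ?x = "X (\<phi> n)"
    have "f ?x \<preceq> F (\<phi> n) ?x"
      using \<epsilon>(1)[of "\<phi> n"] XR(2)[of "\<phi> n"]
      by (simp add: F_def cone_le_def scale_mem interior_mem assms)
    then have "f ?x \<preceq> R (\<phi> n) *\<^sub>R ?x" using XR(4) by simp
    with n XR(1,3) show ?thesis by blast
  qed
  ultimately show thesis by (rule that)
qed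

end

section \<open>The spectral radius\<close>

lemma root_tendsto_of_geometric_bounds:
  fixes A :: "nat \<Rightarrow> real"
  assumes "c > 0" "r \<ge> 0" and lower: "\<And>k. c * r ^ k \<le> A k"
    and upper: "\<And>s. r < s \<Longrightarrow> \<exists>B>0. \<forall>k. A k \<le> B * s ^ k"
  shows "(\<lambda>k. root k (A k)) \<longlonglongrightarrow> r"
proof (rule order_tendstoI)
  fix l assume "l < r"
  have "(\<lambda>k. root k c * r) \<longlonglongrightarrow> 1 * r"
    by (intro tendsto_intros LIMSEQ_root_const assms)
  then have "\<forall>\<^sub>F k in sequentially. l < root k c * r"
    using \<open>l < r\<close> by (intro order_tendstoD) auto
  with eventually_gt_at_top[of 0] show "\<forall>\<^sub>F k in sequentially. l < root k (A k)"
  proof eventually_elim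
    case (elim k)
    then have "root k (c * r ^ k) \<le> root k (A k)" using lower by simp
    with elim assms show ?case by (simp add: real_root_mult real_root_power_cancel)
  qed
next
  fix l assume "r < l"
  then obtain s where s: "r < s" "s < l" using dense by blast
  obtain B where B: "B > 0" "\<And>k. A k \<le> B * s ^ k" using upper[OF s(1)] by blast
  have "(\<lambda>k. root k B * s) \<longlonglongrightarrow> 1 * s"
    by (intro tendsto_intros LIMSEQ_root_const B)
  then have "\<forall>\<^sub>F k in sequentially. root k B * s < l"
    using s by (intro order_tendstoD) auto
  with eventually_gt_at_top[of 0] show "\<forall>\<^sub>F k in sequentially. root k (A k) < l"
  proof eventually_elim
    case (elim k)
    then have "root k (A k) \<le> root k (B * s ^ k)" using B by simp
    with elim assms s show ?case by (simp add: real_root_mult real_root_power_cancel)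
  qed
qed

context cone_selfmap
begin

text \<open>Some multiple of each interior \<open>z\<close> dominates \<open>y\<close>, so normality of the cone turns the order
  bounds into matching geometric bounds on the norms of the orbit of \<open>z\<close>.\<close>

lemma eigenvalue_limit_is_spectral_radius:
  assumes y: "y \<in> C" "y \<noteq> 0" and r: "r \<ge> 0"
    and lower: "\<And>x k. x \<in> interior C \<Longrightarrow> y \<preceq> x \<Longrightarrow> r ^ k *\<^sub>R y \<preceq> (f ^^ k) x"
    and upper: "\<And>s. r < s \<Longrightarrow> \<exists>x\<in>interior C. \<exists>r'>0. r' < s \<and> f x \<preceq> r' *\<^sub>R x"
    and nonzero: "0 \<notin> interior C"
  shows "cone_spectral_radius C f = r"
proof -
  have lim: "(\<lambda>k. root k (norm ((f ^^ k) z))) \<longlonglongrightarrow> r" if z: "z \<in> interior C" for z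
  proof -
    obtain K where K: "K > 0" "\<And>v w. 0 \<preceq> v \<Longrightarrow> v \<preceq> w \<Longrightarrow> norm v \<le> K * norm w"
      using normality by metis
    obtain M where M: "M > 0" "\<And>v. v \<preceq> (M * norm v) *\<^sub>R z"
      using interior_dominates[OF z] by metis
    define t where "t = M * norm y"
    have t: "t > 0" "y \<preceq> t *\<^sub>R z" using M y by (auto simp: t_def)
    have low: "norm y / (K * t) * r ^ k \<le> norm ((f ^^ k) z)" for k
    proof -
      interpret g: cone_selfmap C "f ^^ k" by (rule cone_selfmap_funpow)
      have "r ^ k *\<^sub>R y \<preceq> (f ^^ k) (t *\<^sub>R z)" using t z by (intro lower interior_scale)
      then have "r ^ k *\<^sub>R y \<preceq> t *\<^sub>R (f ^^ k) z" using t z by (simp add: g.f_scale)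
      moreover have "0 \<preceq> r ^ k *\<^sub>R y" using r y by (simp add: cone_le_def scale_mem)
      ultimately have "norm (r ^ k *\<^sub>R y) \<le> K * norm (t *\<^sub>R (f ^^ k) z)" using K(2) by blast
      with t r K(1) show ?thesis by (simp add: field_simps)
    qed
    have up: "\<exists>B>0. \<forall>k. norm ((f ^^ k) z) \<le> B * s ^ k" if "r < s" for s
    proof -
      obtain x r' where x: "x \<in> interior C" "r' > 0" "r' < s" "f x \<preceq> r' *\<^sub>R x"
        using upper[OF \<open>r < s\<close>] by blast
      have "z \<noteq> 0" using z nonzero by blast
      then obtain B where B: "B > 0" "\<And>k. norm ((f ^^ k) z) \<le> B * r' ^ k"
        using norm_funpow_upper[OF x(1,4,2) z] by blast
      have "B * r' ^ k \<le> B * s ^ k" for k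
        using B x by (intro mult_left_mono power_mono) auto
      then have "norm ((f ^^ k) z) \<le> B * s ^ k" for k
        using B(2)[of k] by (rule order_trans[rotated])
      with B(1) show ?thesis by blast
    qed
    show ?thesis
      by (rule root_tendsto_of_geometric_bounds[OF _ r low up]) (use K t y in auto)
  qed
  show ?thesis
    unfolding cone_spectral_radius_def
  proof (rule the_equality)
    show "\<forall>z\<in>interior C. (\<lambda>k. root k (norm ((f ^^ k) z))) \<longlonglongrightarrow> r" using lim by blast
    fix r' assume r': "\<forall>z\<in>interior C. (\<lambda>k. root k (norm ((f ^^ k) z))) \<longlonglongrightarrow> r'"
    obtain z where z: "z \<in> interior C" using int_nonempty by blast
    show "r' = r" using LIMSEQ_unique[OF bspec[OF r' z] lim[OF z]] .
  qed
qed

end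

theorem theorem1:
  fixes C :: "(real ^ 'n) set" and f :: "real ^ 'n \<Rightarrow> real ^ 'n" and \<rho> :: real
  assumes "proper_closed_cone C"
    and "f \<in> interior C \<rightarrow> interior C"
    and "order_preserving C f"
    and "homogeneous C f"
    and "cone_spectral_radius C f = \<rho>"
  shows "\<exists>y \<in> C - {0}. \<forall>x \<in> interior C. cone_le C y x \<longrightarrow>
           (\<forall>k::nat. cone_le C (\<rho> ^ k *\<^sub>R y) ((f ^^ k) x))"
proof -
  interpret cone_selfmap C f
    by unfold_locales (rule assms)+
  \<comment> \<open>In positive dimension a pointed cone is not the whole space.\<close>
  have nonzero: "0 \<notin> interior C"
  proof
    assume "0 \<in> interior C"
    then obtain M where "M > 0" "\<And>x. x \<preceq> (M * norm x) *\<^sub>R 0"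
      using interior_dominates by blast
    then have neg: "- x \<in> C" for x by (simp add: cone_le_def)
    have "x = 0" for x :: "real ^ 'n" using pointed[of x] neg[of x] neg[of "- x"] by simp
    then have "(1 :: real ^ 'n) = 0" .
    then show False by simp
  qed
  obtain u where u: "u \<in> interior C" "u \<noteq> 0" using int_nonempty nonzero by blast
  obtain y r where y: "y \<in> C" "y \<noteq> 0" "r \<ge> 0"
    and lower: "\<And>x k. x \<in> interior C \<Longrightarrow> y \<preceq> x \<Longrightarrow> r ^ k *\<^sub>R y \<preceq> (f ^^ k) x"
    and upper: "\<And>s. r < s \<Longrightarrow> \<exists>x\<in>interior C. \<exists>r'>0. r' < s \<and> f x \<preceq> r' *\<^sub>R x"
    using limit_of_perturbed_eigenvectors[OF u] by blast
  have "\<rho> = r"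
    using eigenvalue_limit_is_spectral_radius[OF y lower upper nonzero] assms(5) by simp
  with y lower show ?thesis by blast
qed

end
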